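(* Let $x$ and $y$ be arbitrary positive real numbers, and let $n$ be any integer. Put $$H=\frac{2xy}{x+y},\qquad G=\sqrt{xy},\qquad A=\frac{x+y}{2},\qquad Q=\sqrt{\frac{x^2+y^2}{2}}.$$ Then $$A\cdot G\ge Q\cdot H$$ and $$A^n+G^n\le Q^n+H^n.$$ The equality in each of these two inequalities holds if and only if $x=y$.
   Context: $H$, $G$, $A$, $Q$ are respectively the harmonic, geometric, arithmetic and quadratic (root mean square) means of the two positive real numbers $x$ and $y$.
   Formalization: The equality criterion for the second inequality is stated only for n ≠ 0, since for n = 0 both sides equal 2 for all x and y (e.g. x = 1, y = 2), so "equality if and only if x = y" fails there; the inequality itself is proved for every integer n. *)

theory Defs imports Complex_Main
begin

end

theory Submission imports Defs
begin

text \<open>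
  Everything rests on the two identities \<open>A H = G\<^sup>2\<close> and \<open>Q\<^sup>2 + G\<^sup>2 = 2 A\<^sup>2\<close>.  The second says that
  \<open>A\<close> is the quadratic mean of \<open>Q\<close> and \<open>G\<close>, so by the mean inequalities for that pair both
  \<open>Q G < A\<^sup>2\<close> and \<open>Q + G < 2 A\<close> when \<open>x \<noteq> y\<close>.  Replacing \<open>H\<close> by \<open>G\<^sup>2 / A\<close>, the former becomes
  \<open>Q H < A G\<close>; and since \<open>(Q - G) (Q + G) = 2 A (A - H)\<close>, the latter becomes
  \<open>A - H < Q - G\<close>, which is the power inequality for \<open>n = 1\<close>.

  A positive exponent \<open>n\<close> follows from \<open>n = 1\<close>, because the interval from \<open>G\<close> to \<open>Q\<close> is longer
  than the interval from \<open>H\<close> to \<open>A\<close> and lies to its right, and \<open>t \<mapsto> t\<^sup>n\<close> is increasing and convex.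
  A negative exponent \<open>n = - m\<close> combines the two strict inequalities:
  \<open>A\<^sup>n + G\<^sup>n = (A\<^sup>m + G\<^sup>m) / (A G)\<^sup>m\<close>, and passing to \<open>Q, H\<close> enlarges the numerator and shrinks
  the denominator.  If \<open>x = y\<close> all four means coincide.
\<close>

text \<open>
  Convexity of the power function in the form of increments: both the length of the interval and
  its position contribute, as the splitting \<open>q\<^sup>m\<^sup>+\<^sup>1 - g\<^sup>m\<^sup>+\<^sup>1 = q (q\<^sup>m - g\<^sup>m) + g\<^sup>m (q - g)\<close> shows.
\<close>

lemma power_increment_less:
  fixes a g h q :: "'a::linordered_idom"
  assumes "0 < h" "h \<le> g" "g \<le> q" "0 \<le> a" "a \<le> q" and less: "a - h < q - g" and "0 < m"
  shows "a ^ m - h ^ m < q ^ m - g ^ m"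
  using \<open>0 < m\<close>
proof (induction m rule: nat_induct_non_zero)
  case 1
  then show ?case using less by simp
next
  case (Suc m)
  have split: "b * (b ^ m - c ^ m) + c ^ m * (b - c) = b ^ Suc m - c ^ Suc m" for b c :: 'a
    by (simp add: algebra_simps)
  have "0 \<le> q ^ m - g ^ m"
    using assms by (simp add: power_mono)
  then have "a * (a ^ m - h ^ m) \<le> q * (q ^ m - g ^ m)"
    using Suc.IH assms by (meson less_imp_le mult_left_mono mult_right_mono order_trans)
  moreover have "h ^ m * (a - h) < g ^ m * (q - g)"
  proof -
    have "h ^ m * (a - h) < h ^ m * (q - g)"
      using assms by (intro mult_strict_left_mono) auto
    also have "\<dots> \<le> g ^ m * (q - g)"
      using assms by (intro mult_right_mono power_mono) auto
    finally show ?thesis .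
  qed
  ultimately show ?case
    unfolding split[symmetric] by (rule add_le_less_mono)
qed

text \<open>
  The four means of two different positive numbers, through the relations between them on which
  the inequalities depend.
\<close>

locale four_means =
  fixes H G A Q :: real
  assumes G_pos: "0 < G" and G_less_A: "G < A" and Q_pos: "0 < Q"
    and AH: "A * H = G\<^sup>2" and QG: "Q\<^sup>2 + G\<^sup>2 = 2 * A\<^sup>2"
begin

lemma A_pos: "0 < A"
  using G_pos G_less_A by simp

lemma H_pos: "0 < H"
  using AH A_pos G_pos by (metis zero_less_mult_pos zero_less_power)

lemma H_less_G: "H < G"
proof -
  have "A * H < A * G"
    using AH G_less_A G_pos by (simp add: power2_eq_square)
  then show ?thesis using A_pos by simp
qed

lemma A_less_Q: "A < Q"
proof -
  have "G\<^sup>2 < A\<^sup>2"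
    using G_less_A G_pos by (simp add: power_strict_mono)
  then have "A\<^sup>2 < Q\<^sup>2" using QG by linarith
  then show ?thesis using Q_pos by (simp add: power_less_imp_less_base)
qed

lemma square_diff_pos: "0 < (Q - G)\<^sup>2"
  using A_less_Q G_less_A by simp

lemma QH_less_AG: "Q * H < A * G"
proof -
  have "Q * G < A\<^sup>2"
    using square_diff_pos QG by (simp add: power2_diff)
  then have "(Q * G) * G < A\<^sup>2 * G"
    using G_pos by simp
  moreover have "A * (Q * H) = (Q * G) * G"
    unfolding mult.left_commute[of A Q H] AH by (simp add: power2_eq_square)
  ultimately have "A * (Q * H) < A * (A * G)"
    by (simp only: power2_eq_square mult.assoc)
  then show ?thesis using A_pos by simp
qed

lemma A_minus_H_less: "A - H < Q - G"
proof -
  have "(Q + G)\<^sup>2 < (2 * A)\<^sup>2"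
    using square_diff_pos QG by (simp add: power2_diff power2_sum power_mult_distrib)
  then have "Q + G < 2 * A"
    by (rule power_less_imp_less_base) (use A_pos in simp)
  then have "(A - H) * (Q + G) < (A - H) * (2 * A)"
    using H_less_G G_less_A by simp
  also have "\<dots> = (Q - G) * (Q + G)"
    using AH QG by (simp add: power2_eq_square algebra_simps)
  finally show ?thesis using Q_pos G_pos by simp
qed

lemma power_sum_less:
  assumes "0 < m"
  shows "A ^ m + G ^ m < Q ^ m + H ^ m"
proof -
  have "A ^ m - H ^ m < Q ^ m - G ^ m"
    using H_pos H_less_G G_less_A A_less_Q A_pos A_minus_H_less assms
    by (intro power_increment_less) auto
  then show ?thesis by simp
qed

lemma powi_sum_less:
  assumes "n \<noteq> 0"
  shows "A powi n + G powi n < Q powi n + H powi n"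
proof (cases "0 < n")
  case True
  then show ?thesis
    using power_sum_less[of "nat n"] by (simp add: power_int_def)
next
  case False
  define m where "m = nat (- n)"
  have "0 < m" using False assms by (simp add: m_def)
  have common_denominator: "b powi n + c powi n = (b ^ m + c ^ m) / (b * c) ^ m"
    if "0 < b" "0 < c" for b c :: real
    using that False assms by (simp add: power_int_def m_def field_simps)
  have "(A ^ m + G ^ m) / (A * G) ^ m < (Q ^ m + H ^ m) / (Q * H) ^ m"
  proof (rule frac_less)
    show "(Q * H) ^ m \<le> (A * G) ^ m"
      using QH_less_AG Q_pos H_pos by (intro power_mono) auto
  qed (use A_pos G_pos Q_pos H_pos power_sum_less \<open>0 < m\<close> in auto)
  then show ?thesis
    using common_denominator A_pos G_pos Q_pos H_pos by simp
qed

end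

theorem theorem1p1:
  fixes x y H G A Q :: real and n :: int
  assumes "x > 0" and "y > 0"
    and "H = 2 * x * y / (x + y)"
    and "G = sqrt (x * y)"
    and "A = (x + y) / 2"
    and "Q = sqrt ((x^2 + y^2) / 2)"
  shows "A * G \<ge> Q * H \<and> (A * G = Q * H \<longleftrightarrow> x = y)
    \<and> A powi n + G powi n \<le> Q powi n + H powi n
    \<and> (n \<noteq> 0 \<longrightarrow> (A powi n + G powi n = Q powi n + H powi n \<longleftrightarrow> x = y))"
proof (cases "x = y")
  case True
  then have "H = x" "G = x" "A = x" "Q = x"
    using assms by auto
  then show ?thesis using True by simp
next
  case False
  have G2: "G\<^sup>2 = x * y" and Q2: "Q\<^sup>2 = (x\<^sup>2 + y\<^sup>2) / 2"
    using assms by simp_all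
  interpret four_means H G A Q
  proof
    show "0 < G" using assms by simp
    show "0 < Q" using assms by (simp add: add_pos_pos)
    show "A * H = G\<^sup>2" unfolding G2 \<open>A = _\<close> \<open>H = _\<close> using assms(1,2) by simp
    show "Q\<^sup>2 + G\<^sup>2 = 2 * A\<^sup>2"
      unfolding G2 Q2 \<open>A = _\<close> by (simp add: power2_sum power_divide)
    have "0 < (x - y)\<^sup>2" using False by simp
    then have "G\<^sup>2 < A\<^sup>2"
      unfolding G2 \<open>A = _\<close> by (simp add: power2_sum power2_diff power_divide)
    then show "G < A"
      by (rule power_less_imp_less_base) (use assms in simp)
  qed
  have "A powi n + G powi n \<le> Q powi n + H powi n"
    using powi_sum_less by (cases "n = 0") (auto intro: less_imp_le)
  then show ?thesis
    using False QH_less_AG powi_sum_less by force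
qed

end
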